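(* For every integer $k\ge 6$, we have $r_k(k+1,k+1)> s_3\left(\lfloor k/2\rfloor-2\right)$.
   Context: Write $[n]=\{1,\dots,n\}$ and let $\binom{[N]}{k}$ denote the set of $k$-element subsets of $[N]$. The Ramsey number $r_k(s,m)$ is the smallest integer $N$ such that every red/blue coloring of the $k$-subsets of $[N]$ contains either an $s$-element subset of $[N]$ all of whose $k$-subsets are red or an $m$-element subset of $[N]$ all of whose $k$-subsets are blue. For integers $N,k\ge 1$, the shift graph $\operatorname{Sh}(N,k)$ is the directed graph with vertex set $\binom{[N]}{k}$ in which, for all $x_1<x_2<\cdots<x_{k+1}$ in $[N]$, there is an arc $\{x_1,\ldots,x_k\}\to\{x_2,\ldots,x_{k+1}\}$ (and no other arcs). Its chromatic number $\chi(\operatorname{Sh}(N,k))$ is that of the underlying undirected graph. The $3$-color shift number is $s_3(k)=\max\{N:\chi(\operatorname{Sh}(N,k))\le 3\}$ (this maximum exists, since for fixed $k$ Ramsey's theorem gives $\chi(\operatorname{Sh}(N,k))\to\infty$ as $N\to\infty$). *)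

theory Defs
  imports "HOL-Library.Ramsey" "Graph_Theory.Graph_Theory"
begin

text \<open>Colour 0 is red and colour 1 is blue.\<close>

definition ramsey_number :: "nat \<Rightarrow> nat \<Rightarrow> nat \<Rightarrow> nat" where
  "ramsey_number k s m = (LEAST N. partn_lst {1..N} [s, m] k)"

definition shift_graph :: "nat \<Rightarrow> nat \<Rightarrow> nat set pair_pre_digraph" where
  "shift_graph N k =
    \<lparr> pverts = nsets {1..N} k,
      parcs = {(x ` {1..k}, x ` {2..k+1}) | x :: nat \<Rightarrow> nat.
                 strict_mono_on {1..k+1} x \<and> x ` {1..k+1} \<subseteq> {1..N}} \<rparr>"

definition proper_coloring :: "'a pair_pre_digraph \<Rightarrow> nat \<Rightarrow> ('a \<Rightarrow> nat) \<Rightarrow> bool" where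
  "proper_coloring G n c \<longleftrightarrow>
    c \<in> pverts G \<rightarrow> {..<n} \<and> (\<forall>(u, v) \<in> parcs G. c u \<noteq> c v)"

text \<open>Here \<^const>\<open>mk_symmetric\<close> passes to the underlying undirected graph.
  The definition is meaningful for finite loopless graphs only.\<close>

definition chromatic_number :: "'a pair_pre_digraph \<Rightarrow> nat" where
  "chromatic_number G = (LEAST n. \<exists>c. proper_coloring (mk_symmetric (with_proj G)) n c)"

definition shift_number3 :: "nat \<Rightarrow> nat" where
  "shift_number3 k = Max {N. 1 \<le> N \<and> chromatic_number (shift_graph N k) \<le> 3}"

text \<open>The minima exist, and the maximum exists for \<open>k \<ge> 1\<close>, so these are genuine
  extremal values.\<close>

lemma partn_lst_lepoll:
  assumes A: "partn_lst A qs k" and "A \<lesssim> B"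
  shows "partn_lst B qs k"
  unfolding partn_lst_def monochromatic_def
proof
  fix f :: "'b set \<Rightarrow> nat"
  assume f: "f \<in> nsets B k \<rightarrow> {..<length qs}"
  obtain g where g: "inj_on g A" "g ` A \<subseteq> B"
    using \<open>A \<lesssim> B\<close> by (auto simp: lepoll_def)
  then have "f \<circ> (\<lambda>X. g ` X) \<in> nsets A k \<rightarrow> {..<length qs}"
    by (intro nsets_compose_image_funcset[OF f]) auto
  then obtain i H where i: "i < length qs" and H: "H \<in> nsets A (qs ! i)"
    and m: "(f \<circ> (\<lambda>X. g ` X)) ` nsets H k \<subseteq> {i}"
    using partn_lstE[OF A _ refl] by blast
  have inj: "inj_on g H"
    using g(1) H by (auto simp: nsets_def intro: inj_on_subset)
  then have "g ` H \<in> nsets B (qs ! i)"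
    using g H by (auto simp: nsets_def card_image)
  moreover have "f ` nsets (g ` H) k \<subseteq> {i}"
    using m inj by (fastforce elim: nset_image_obtains)
  ultimately show "\<exists>i<length qs. \<exists>H\<in>nsets B (qs ! i). f ` nsets H k \<subseteq> {i}"
    using i by blast
qed

lemma ramsey_number_works: "partn_lst {1..ramsey_number k s m} [s, m] k"
proof -
  obtain N :: nat where N: "partn_lst {..<N} [s, m] k"
    using ramsey_full by blast
  have "{..<N} \<lesssim> {1..N}"
    by (simp add: lepoll_iff_card_le)
  from partn_lst_lepoll[OF N this] show ?thesis
    unfolding ramsey_number_def by (rule LeastI)
qed

lemma pair_digraph_shift_graph:
  assumes "1 \<le> k"
  shows "pair_digraph (shift_graph N k)"
proof
  have card: "card (x ` A) = card A" if "strict_mono_on {1..k+1} x" "A \<subseteq> {1..k+1}" for x :: "nat \<Rightarrow> nat" and A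
    using that by (meson card_image inj_on_subset strict_mono_on_imp_inj_on)
  show "fst e \<in> pverts (shift_graph N k)" if "e \<in> parcs (shift_graph N k)" for e
    using that by (fastforce simp: shift_graph_def nsets_def card)
  show "snd e \<in> pverts (shift_graph N k)" if "e \<in> parcs (shift_graph N k)" for e
    using that by (fastforce simp: shift_graph_def nsets_def card)
  show fin: "finite (pverts (shift_graph N k))"
    by (simp add: shift_graph_def finite_imp_finite_nsets)
  have "x ` {1..k} \<subseteq> {1..N} \<and> x ` {2..k+1} \<subseteq> {1..N}"
    if "x ` {1..k+1} \<subseteq> {1..N}" for x :: "nat \<Rightarrow> nat"
    using image_mono[of "{1..k}" "{1..k+1}" x] image_mono[of "{2..k+1}" "{1..k+1}" x] that
    by auto
  then have "parcs (shift_graph N k) \<subseteq> Pow {1..N} \<times> Pow {1..N}"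
    unfolding shift_graph_def pair_pre_digraph.simps by blast
  then show "finite (parcs (shift_graph N k))"
    by (rule finite_subset) simp
  show "fst e \<noteq> snd e" if e: "e \<in> parcs (shift_graph N k)" for e
  proof
    assume eq: "fst e = snd e"
    obtain x where x: "strict_mono_on {1..k+1} x" "e = (x ` {1..k}, x ` {2..k+1})"
      using e unfolding shift_graph_def pair_pre_digraph.simps by blast
    have "x 1 \<in> x ` {2..k+1}"
      using x(2) eq assms by (metis atLeastAtMost_iff fst_conv imageI order_refl snd_conv)
    then obtain i where i: "2 \<le> i" "i \<le> k+1" "x 1 = x i" by auto
    moreover have "x 1 < x i"
      using strict_mono_onD[OF x(1), of 1 i] i by auto
    ultimately show False by simp
  qed
qed

lemma chromatic_number_works:
  assumes "pair_digraph G"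
  obtains c where "proper_coloring (mk_symmetric (with_proj G)) (chromatic_number G) c"
proof -
  interpret pair_digraph G by fact
  obtain c :: "'a \<Rightarrow> nat" where c: "inj_on c (pverts G)" "c ` pverts G = {..<card (pverts G)}"
    using ex_bij_betw_finite_nat[OF finite_verts] by (auto simp: bij_betw_def atLeast0LessThan)
  have "c u \<noteq> c v" if "(u, v) \<in> parcs G" for u v
    using that c(1) no_loops' in_arcsD1 in_arcsD2 by (metis inj_onD)
  then have "proper_coloring (mk_symmetric (with_proj G)) (card (pverts G)) c"
    using c(2) by (fastforce simp: proper_coloring_def parcs_mk_symmetric)
  then have "\<exists>c. proper_coloring (mk_symmetric (with_proj G)) (chromatic_number G) c"
    unfolding chromatic_number_def
    by (rule LeastI[of "\<lambda>n. \<exists>c. proper_coloring (mk_symmetric (with_proj G)) n c", OF exI])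
  then show thesis using that by blast
qed

lemma finite_shift_number3:
  assumes "1 \<le> k"
  shows "finite {N. 1 \<le> N \<and> chromatic_number (shift_graph N k) \<le> 3}"
proof -
  obtain M :: nat where M: "partn_lst {..<M} [k+1, k+1, k+1] k"
    using ramsey_full by blast
  have "N < M" if N: "chromatic_number (shift_graph N k) \<le> 3" for N
  proof (rule ccontr)
    assume "\<not> N < M"
    then have "{..<M} \<lesssim> {1..N}" by (simp add: lepoll_iff_card_le)
    then have P: "partn_lst {1..N} [k+1, k+1, k+1] k" by (rule partn_lst_lepoll[OF M])
    obtain c where c: "proper_coloring (mk_symmetric (with_proj (shift_graph N k)))
        (chromatic_number (shift_graph N k)) c"
      using chromatic_number_works[OF pair_digraph_shift_graph[OF assms]] by blast
    have verts: "pverts (shift_graph N k) = nsets {1..N} k"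
      by (simp add: shift_graph_def)
    have "c \<in> nsets {1..N} k \<rightarrow> {..<chromatic_number (shift_graph N k)}"
      using c by (simp add: proper_coloring_def verts)
    then have "c \<in> nsets {1..N} k \<rightarrow> {..<3}"
      using N by (fastforce simp: Pi_iff)
    then obtain i H where i: "i < 3" and H: "H \<in> nsets {1..N} ([k+1, k+1, k+1] ! i)"
      and m: "c ` nsets H k \<subseteq> {i}"
      using partn_lstE[OF P] by (metis length_Cons list.size(3) numeral_3_eq_3)
    have "[k+1, k+1, k+1] ! i = k+1" using i by (auto simp: less_Suc_eq numeral_3_eq_3)
    then have H: "H \<subseteq> {1..N}" "finite H" "card H = k+1" using H by (auto simp: nsets_def)
    define x where "x = (\<lambda>i. sorted_list_of_set H ! (i - 1))"
    have sm: "strict_mono_on {1..k+1} x"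
      unfolding strict_mono_on_def x_def
      using sorted_wrt_nth_less[OF strict_sorted_list_of_set[of H]] H by auto
    have xH: "x ` {1..k+1} \<subseteq> H"
      using H nth_mem[of _ "sorted_list_of_set H"] by (auto simp: x_def)
    have arc: "(x ` {1..k}, x ` {2..k+1}) \<in> parcs (shift_graph N k)"
      using sm xH H(1) by (auto simp: shift_graph_def)
    have "x ` {1..k} \<in> nsets H k" "x ` {2..k+1} \<in> nsets H k"
      using pair_wf_digraph.in_arcsD1[OF _ arc] pair_wf_digraph.in_arcsD2[OF _ arc]
        pair_digraph_shift_graph[OF assms, of N] xH
      by (auto simp: shift_graph_def nsets_def pair_digraph_def pair_fin_digraph_def)
    then have "c (x ` {1..k}) = c (x ` {2..k+1})" using m by blast
    moreover have "c (x ` {1..k}) \<noteq> c (x ` {2..k+1})"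
      using c arc by (fastforce simp: proper_coloring_def parcs_mk_symmetric)
    ultimately show False by simp
  qed
  then show ?thesis by (auto intro: finite_subset[of _ "{..<M}"])
qed

lemma one_in_shift_number3:
  assumes "1 \<le> k"
  shows "1 \<in> {N. 1 \<le> N \<and> chromatic_number (shift_graph N k) \<le> 3}"
proof -
  have none: "parcs (shift_graph 1 k) = {}"
  proof -
    have False if "strict_mono_on {1..k+1} x" "x ` {1..k+1} \<subseteq> {1..1}" for x :: "nat \<Rightarrow> nat"
    proof -
      have "x 1 < x 2" using that(1) assms by (auto intro: strict_mono_onD)
      moreover have "x 1 \<in> {1..1}" "x 2 \<in> {1..1}"
        using subsetD[OF that(2), of "x 1"] subsetD[OF that(2), of "x 2"] assms by auto
      ultimately show False by simp
    qed
    then show ?thesis by (fastforce simp: shift_graph_def)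
  qed
  have "proper_coloring (mk_symmetric (with_proj (shift_graph 1 k))) 3 (\<lambda>_. 0)"
    using none by (simp add: proper_coloring_def parcs_mk_symmetric)
  then have "chromatic_number (shift_graph 1 k) \<le> 3"
    unfolding chromatic_number_def by (blast intro: Least_le)
  then show ?thesis by simp
qed

end

theory Submission
  imports Defs
begin

text \<open>
  Let \<open>m = \<lfloor>k/2\<rfloor> - 2\<close> and let \<open>c\<close> be a proper 3-colouring of \<open>Sh(N, m)\<close>. Along an increasing
  sequence, label each window of \<open>m + 1\<close> consecutive terms by whether \<open>c\<close> ascends from its first to
  its last \<open>m\<close> terms. As \<open>c\<close> is proper with only three colours, no three consecutive labels agree.
  Colour a \<open>k\<close>-set by a Boolean function of its first two labels \<open>p, q\<close> and its last two \<open>r, s\<close>.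
  For a \<open>(k + 1)\<close>-set with first labels \<open>a1, a2, a3\<close> and last labels \<open>b0, b1, b2\<close>, the deletion
  of the least, of the greatest and of the \<open>(m + 3)\<close>-rd element gives \<open>k\<close>-sets with labels
  \<open>(a2, a3; b1, b2)\<close>, \<open>(a1, a2; b0, b1)\<close> and \<open>(a1, a2; b1, b2)\<close>: because \<open>k \<ge> 2 m + 4\<close>, the last
  deletion disturbs neither end. The function is chosen so that its three values never all agree.
\<close>

definition window :: "nat \<Rightarrow> nat list \<Rightarrow> nat \<Rightarrow> nat set" where
  "window m xs i = set (take m (drop i xs))"

definition ascent :: "(nat set \<Rightarrow> nat) \<Rightarrow> nat \<Rightarrow> nat list \<Rightarrow> nat \<Rightarrow> bool" where
  "ascent c m xs i \<longleftrightarrow> c (window m xs i) < c (window m xs (Suc i))"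

text \<open>Found by exhaustive search over Boolean functions of the four labels.\<close>

definition combine :: "bool \<Rightarrow> bool \<Rightarrow> bool \<Rightarrow> bool \<Rightarrow> bool" where
  "combine p q r s \<longleftrightarrow> q = (if p = q then s else r)"

text \<open>With positions counted from 0, the label at \<open>i\<close> reads entries
  \<open>i\<close> to \<open>i + m\<close>, so the last label of a list of length \<open>k\<close>
  is at \<open>k - m - 1\<close>.\<close>

definition end_coloring :: "(nat set \<Rightarrow> nat) \<Rightarrow> nat \<Rightarrow> nat \<Rightarrow> nat set \<Rightarrow> nat" where
  "end_coloring c m k X = (let a = ascent c m (sorted_list_of_set X) in
     of_bool (combine (a 0) (a 1) (a (k - m - 2)) (a (k - m - 1))))"

text \<open>If \<open>a1 = a2\<close>, then \<open>a3 \<noteq> a2\<close>, and the first two values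
  test \<open>b1\<close> against \<open>a3\<close> and \<open>a2\<close>, so they differ. If
  \<open>a1 \<noteq> a2\<close> and \<open>a2 \<noteq> a3\<close>, the first and third values do the
  same. If \<open>a1 \<noteq> a2\<close> and \<open>a2 = a3\<close>, the values test
  \<open>a2\<close> against \<open>b2\<close>, \<open>b0\<close>, \<open>b1\<close>, which are not
  all equal.\<close>

lemma combine_not_constant:
  assumes "\<not> (a1 = a2 \<and> a2 = a3)" "\<not> (b0 = b1 \<and> b1 = b2)"
  shows "\<not> (combine a2 a3 b1 b2 = combine a1 a2 b0 b1 \<and> combine a1 a2 b0 b1 = combine a1 a2 b1 b2)"
  using assms unfolding combine_def by (cases a1; cases a2; cases a3) auto

lemma window_drop: "window m (drop j xs) i = window m xs (i + j)"
  by (simp add: window_def add.commute)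

lemma window_take: "i + m \<le> j \<Longrightarrow> window m (take j xs) i = window m xs i"
  by (simp add: window_def drop_take min_def)

lemma window_append1: "i + m \<le> length xs \<Longrightarrow> window m (xs @ ys) i = window m xs i"
  by (simp add: window_def)

lemma window_append2: "length xs \<le> i \<Longrightarrow> window m (xs @ ys) i = window m ys (i - length xs)"
  by (simp add: window_def)

context
  fixes N m n :: nat and c :: "nat set \<Rightarrow> nat"
  assumes c: "proper_coloring (mk_symmetric (with_proj (shift_graph N m))) n c"
begin

lemma color_window_less:
  assumes "sorted_wrt (<) xs" "set xs \<subseteq> {1..N}" "i + m \<le> length xs"
  shows "c (window m xs i) < n"
proof -
  have "distinct (take m (drop i xs))"
    using assms(1) strict_sorted_iff[of xs] by simp
  moreover have "window m xs i \<subseteq> {1..N}"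
    using assms(2) unfolding window_def by (meson order_trans set_drop_subset set_take_subset)
  ultimately have "window m xs i \<in> nsets {1..N} m"
    using assms(3) by (auto simp: nsets_def window_def distinct_card)
  then show ?thesis
    using c by (auto simp: proper_coloring_def shift_graph_def)
qed

lemma color_window_neq:
  assumes "sorted_wrt (<) xs" "set xs \<subseteq> {1..N}" "i + m < length xs"
  shows "c (window m xs i) \<noteq> c (window m xs (Suc i))"
proof -
  \<comment> \<open>Arcs are indexed from 1 and lists from 0, hence the shift by one.\<close>
  define x where "x = (\<lambda>j. xs ! (i + j - 1))"
  have mono: "strict_mono_on {1..m+1} x"
    using assms(3) by (auto simp: strict_mono_on_def x_def intro!: sorted_wrt_nth_less[OF assms(1)])
  have sub: "x ` {1..m+1} \<subseteq> {1..N}"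
  proof
    fix y assume "y \<in> x ` {1..m+1}"
    then obtain j where "1 \<le> j" "j \<le> m + 1" "y = xs ! (i + j - 1)"
      by (auto simp: x_def)
    then show "y \<in> {1..N}"
      using nth_mem[of "i + j - 1" xs] assms(2,3) by (simp add: subset_iff)
  qed
  have window_eq: "window m xs l = (\<lambda>j. xs ! (l + j)) ` {..<m}" if "l + m \<le> length xs" for l
    using that nth_image[of m "drop l xs"]
    by (simp add: window_def atLeast0LessThan cong: image_cong_simp)
  have "window m xs i = x ` Suc ` {..<m}"
    using window_eq[of i] assms(3) by (simp add: image_image x_def)
  moreover have "window m xs (Suc i) = x ` Suc ` Suc ` {..<m}"
    using window_eq[of "Suc i"] assms(3) by (simp add: image_image x_def)
  moreover have "Suc ` {..<m} = {1..m}" "Suc ` {1..m} = {2..m+1}"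
    by (simp_all add: image_Suc_lessThan numeral_2_eq_2)
  ultimately have "(window m xs i, window m xs (Suc i)) \<in> parcs (shift_graph N m)"
    using mono sub unfolding shift_graph_def by auto
  then show ?thesis
    using c by (fastforce simp: proper_coloring_def parcs_mk_symmetric)
qed

text \<open>Adjacent windows have different colours, so three equal labels would make four
  successive colours strictly monotone, impossible with at most three colours.\<close>

lemma ascent_not_constant:
  assumes "n \<le> 3" "sorted_wrt (<) xs" "set xs \<subseteq> {1..N}" "i + m + 2 < length xs"
  shows "\<not> (ascent c m xs i = ascent c m xs (Suc i) \<and>
            ascent c m xs (Suc i) = ascent c m xs (Suc (Suc i)))"
proof -
  let ?c = "\<lambda>j. c (window m xs j)"
  have "?c j < 3" if "j + m \<le> length xs" for j
    using color_window_less[OF assms(2,3) that] assms(1) by linarith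
  then have less: "?c i < 3" "?c (Suc (Suc (Suc i))) < 3"
    using assms(4) by simp_all
  have neq: "?c i \<noteq> ?c (Suc i)" "?c (Suc i) \<noteq> ?c (Suc (Suc i))"
    "?c (Suc (Suc i)) \<noteq> ?c (Suc (Suc (Suc i)))"
    using color_window_neq[OF assms(2,3)] assms(4) by simp_all
  show ?thesis
  proof (cases "?c i < ?c (Suc i)")
    case True
    then show ?thesis using less unfolding ascent_def by linarith
  next
    case False
    then show ?thesis using less neq unfolding ascent_def by linarith
  qed
qed

lemma not_partn_lst_if_shift_coloring:
  assumes "n \<le> 3" "2 * m + 4 \<le> k"
  shows "\<not> partn_lst {1..N} [k + 1, k + 1] k"
proof
  let ?f = "end_coloring c m k"
  assume "partn_lst {1..N} [k + 1, k + 1] k"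
  moreover have "?f \<in> nsets {1..N} k \<rightarrow> {..<length [k + 1, k + 1]}"
    by (auto simp: end_coloring_def Let_def)
  ultimately obtain i H where "i < length [k + 1, k + 1]"
    and "H \<in> nsets {1..N} ([k + 1, k + 1] ! i)" and mono: "?f ` nsets H k \<subseteq> {i}"
    using partn_lstE[OF _ _ refl] by metis
  then have H: "H \<subseteq> {1..N}" "finite H" "card H = k + 1"
    by (auto simp: nsets_def less_Suc_eq)
  define ys where "ys = sorted_list_of_set H"
  have ys: "sorted_wrt (<) ys" "set ys = H" "length ys = k + 1"
    using H by (simp_all add: ys_def)
  let ?a = "ascent c m ys"
  have f_eq: "?f (set xs) = of_bool (combine (ascent c m xs 0) (ascent c m xs 1)
      (ascent c m xs (k - m - 2)) (ascent c m xs (k - m - 1)))"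
    and f_i: "?f (set xs) = i"
    if "sorted_wrt (<) xs" "set xs \<subseteq> H" "length xs = k" for xs
  proof -
    have "sorted_list_of_set (set xs) = xs"
      using that(1) sorted_list_of_set.idem_if_sorted_distinct strict_sorted_iff by blast
    then show "?f (set xs) = of_bool (combine (ascent c m xs 0) (ascent c m xs 1)
      (ascent c m xs (k - m - 2)) (ascent c m xs (k - m - 1)))"
      by (simp add: end_coloring_def Let_def)
    have "set xs \<in> nsets H k"
      using that strict_sorted_iff[of xs] distinct_card[of xs] by (simp add: nsets_def)
    then show "?f (set xs) = i" using mono by blast
  qed
  \<comment> \<open>The labels of \<open>ys\<close> at \<open>j\<close>, \<open>j + 1\<close> and
    \<open>j + 2\<close> are its last three.\<close>
  define j where "j = k - m - 2"
  have j: "k - m - 2 = j" "k - m - 1 = Suc j" "m + 2 \<le> j" "k = j + m + 2"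
    using assms(2) by (auto simp: j_def)
  define tail where "tail = drop 1 ys"
  define init where "init = take k ys"
  \<comment> \<open>The entry at \<open>m + 2\<close> is removed. Labels 0 and 1 read entries up to
    \<open>m + 1\<close> only; labels from \<open>j \<ge> m + 2\<close> on lie behind the gap and
    shift by one.\<close>
  define mid where "mid = take (m + 2) ys @ drop (m + 3) ys"
  have tail: "sorted_wrt (<) tail" "set tail \<subseteq> H" "length tail = k"
    using ys set_drop_subset[of 1 ys] by (auto simp: tail_def)
  have init: "sorted_wrt (<) init" "set init \<subseteq> H" "length init = k"
    using ys set_take_subset[of k ys] by (auto simp: init_def)
  have "ys = take (m + 2) ys @ ys ! (m + 2) # drop (m + 3) ys"
    using ys(3) j id_take_nth_drop[of "m + 2" ys] by (simp add: eval_nat_numeral)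
  then have "sorted_wrt (<) (take (m + 2) ys @ ys ! (m + 2) # drop (m + 3) ys)"
    using ys(1) by simp
  then have "sorted_wrt (<) mid"
    by (simp add: mid_def sorted_wrt_append)
  then have mid: "sorted_wrt (<) mid" "set mid \<subseteq> H" "length mid = k"
    using ys j set_take_subset[of "m + 2" ys] set_drop_subset[of "m + 3" ys]
    by (auto simp: mid_def)
  have a_tail: "ascent c m tail l = ?a (Suc l)" for l
    by (simp add: tail_def ascent_def window_drop)
  have a_init: "ascent c m init l = ?a l" if "l + m < k" for l
    using that by (simp add: init_def ascent_def window_take)
  have a_mid1: "ascent c m mid l = ?a l" if "l \<le> 1" for l
    using that ys(3) j by (simp add: mid_def ascent_def window_append1 window_take)
  have a_mid2: "ascent c m mid l = ?a (Suc l)" if "m + 2 \<le> l" for l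
    using that ys(3) j by (simp add: mid_def ascent_def window_append2 window_drop Suc_diff_le)
  have "\<not> (?a 0 = ?a 1 \<and> ?a 1 = ?a 2)"
    using ascent_not_constant[OF assms(1) ys(1), of 0] H(1) ys j by (simp add: numeral_2_eq_2)
  moreover have "\<not> (?a j = ?a (Suc j) \<and> ?a (Suc j) = ?a (Suc (Suc j)))"
    using ascent_not_constant[OF assms(1) ys(1), of j] H(1) ys j by simp
  ultimately have "\<not> (combine (?a 1) (?a 2) (?a (Suc j)) (?a (Suc (Suc j))) =
      combine (?a 0) (?a 1) (?a j) (?a (Suc j)) \<and>
    combine (?a 0) (?a 1) (?a j) (?a (Suc j)) =
      combine (?a 0) (?a 1) (?a (Suc j)) (?a (Suc (Suc j))))"
    by (rule combine_not_constant)
  moreover have "?f (set tail) = of_bool (combine (?a 1) (?a 2) (?a (Suc j)) (?a (Suc (Suc j))))"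
    unfolding f_eq[OF tail] j(1,2) by (simp add: a_tail numeral_2_eq_2)
  moreover have "?f (set init) = of_bool (combine (?a 0) (?a 1) (?a j) (?a (Suc j)))"
    unfolding f_eq[OF init] j(1,2) using j(3,4) by (simp add: a_init)
  moreover have "?f (set mid) = of_bool (combine (?a 0) (?a 1) (?a (Suc j)) (?a (Suc (Suc j))))"
    unfolding f_eq[OF mid] j(1,2) using j(3) by (simp add: a_mid1 a_mid2)
  ultimately show False
    unfolding f_i[OF tail] f_i[OF init] f_i[OF mid] by (metis of_bool_eq_iff)
qed

end

theorem theorem1p2:
  fixes k :: nat
  assumes "6 \<le> k"
  shows "ramsey_number k (k + 1) (k + 1) > shift_number3 (k div 2 - 2)"
proof (rule ccontr)
  let ?m = "k div 2 - 2"
  let ?N = "shift_number3 ?m"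
  assume "\<not> ?thesis"
  then have "{1..ramsey_number k (k + 1) (k + 1)} \<lesssim> {1..?N}"
    by (simp add: lepoll_iff_card_le)
  with ramsey_number_works have P: "partn_lst {1..?N} [k + 1, k + 1] k"
    by (rule partn_lst_lepoll)
  have m: "1 \<le> ?m" "2 * ?m + 4 \<le> k"
    using assms by auto
  \<comment> \<open>The maximum is attained, since its set is finite and contains 1.\<close>
  have "?N \<in> {N. 1 \<le> N \<and> chromatic_number (shift_graph N ?m) \<le> 3}"
    unfolding shift_number3_def
    using Max_in[OF finite_shift_number3[OF m(1)]] one_in_shift_number3[OF m(1)] by blast
  then have "chromatic_number (shift_graph ?N ?m) \<le> 3" by simp
  moreover obtain c where "proper_coloring (mk_symmetric (with_proj (shift_graph ?N ?m)))
      (chromatic_number (shift_graph ?N ?m)) c"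
    using chromatic_number_works[OF pair_digraph_shift_graph[OF m(1)]] .
  ultimately show False
    using not_partn_lst_if_shift_coloring[OF _ _ m(2)] P by blast
qed

end
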